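(* Let $\mathcal{C}\subseteq\mathbb{F}_2^N$ be an $(N,K)$ binary linear block code, let $h^{A},h^{B}\in\mathbb{C}$ and $\sigma^2>0$. Let $\mathbf{y}\in\mathbb{C}^N$ be any output of the original channel, let $\mathbf{z}\in\{-1,+1\}^N$ be any realization of the random signs of the degraded channel, and let $\tilde{\mathbf{y}}=\mathbf{y}\odot\mathbf{z}$ (entrywise product) be the corresponding output of the equivalent degraded channel (EDC). Then the maximum-likelihood (ML) decision over the EDC given $\tilde{\mathbf{y}}$ coincides with the maximum-metric (MM) XOR-CD decision over the original channel given $\mathbf{y}$, i.e. $$\arg\max_{\mathbf{c}\in\mathcal{C}}\ \phi_{\mathrm{ML}}^{\mathrm{EDC}}(\tilde{\mathbf{y}},\mathbf{c})=\arg\max_{\mathbf{c}\in\mathcal{C}}\ \phi_{\mathrm{XC}}(\mathbf{y},\mathbf{c}),$$ where $\arg\max$ denotes the set of maximizers.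
   Context: Setting: two users A and B use the same $(N,K)$ binary linear block code $\mathcal{C}$ (a $K$-dimensional linear subspace of $\mathbb{F}_2^N$) and transmit codewords $\mathbf{a},\mathbf{b}\in\mathcal{C}$ with BPSK modulation $\mathtt{m}(0)=+1$, $\mathtt{m}(1)=-1$ simultaneously to a relay, which wants to decode $\mathbf{c}=\mathbf{a}+\mathbf{b}$ (sum in $\mathbb{F}_2^N$). The complex channel coefficients are $h^{A},h^{B}\in\mathbb{C}$, and the noise is i.i.d. complex Gaussian with zero mean and variance $2\sigma^2$. Original channel: for $y\in\mathbb{C}$ and $a,b\in\mathbb{F}_2$, $$p_{Y|AB}(y|a,b)=\frac{1}{2\pi\sigma^2}\exp\left(\frac{-|y-h^{A}\mathtt{m}(a)-h^{B}\mathtt{m}(b)|^2}{2\sigma^2}\right),$$ and the channel is memoryless: $p_{\mathbf{Y}|\mathbf{A}\mathbf{B}}(\mathbf{y}|\mathbf{a},\mathbf{b})=\prod_{i=1}^N p_{Y|AB}(y_i|a_i,b_i)$. MM XOR-CD decoder on the original channel: it maximizes over $\mathbf{c}\in\mathcal{C}$ the metric $$\phi_{\mathrm{XC}}(\mathbf{y},\mathbf{c})=\prod_{i=1}^{N}\ \sum_{\substack{a_i,b_i\in\mathbb{F}_2:\\ a_i+b_i=c_i}}p_{Y|AB}(y_i|a_i,b_i).$$ Equivalent degraded channel (EDC): each output $y_i$ of the original channel is multiplied by an independent sign $z_i$, uniform on $\{-1,+1\}$, giving $\tilde{y}_i=y_iz_i$. Its transition density is $$p_{\tilde{Y}|AB}(\tilde{y}|a,b)=\tfrac12\left[p_{Y|AB}(\tilde{y}|a,b)+p_{Y|AB}(-\tilde{y}|a,b)\right].$$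 ML decoder on the EDC: it maximizes over $\mathbf{c}\in\mathcal{C}$ the metric $$\phi_{\mathrm{ML}}^{\mathrm{EDC}}(\tilde{\mathbf{y}},\mathbf{c})=\sum_{\substack{\mathbf{a},\mathbf{b}\in\mathcal{C}:\\ \mathbf{a}+\mathbf{b}=\mathbf{c}}}\ \prod_{i=1}^{N}p_{\tilde{Y}|AB}(\tilde{y}_i|a_i,b_i).$$ *)

theory Defs
  imports "HOL-Analysis.Analysis" "HOL-Library.Z2"
begin

definition binary_linear_code :: "nat \<Rightarrow> nat \<Rightarrow> (bit ^ 'n) set \<Rightarrow> bool" where
  "binary_linear_code N K C \<longleftrightarrow> CARD('n) = N \<and> vec.subspace C \<and> vec.dim C = K"

definition bpsk :: "bit \<Rightarrow> complex" where
  "bpsk x = (if x = 0 then 1 else -1)"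

text \<open>
  Circularly symmetric complex Gaussian noise of total variance \<open>2 * \<sigma>\<^sup>2\<close>,
  that is, variance \<open>\<sigma>\<^sup>2\<close> per real dimension.
\<close>
definition chan :: "complex \<Rightarrow> complex \<Rightarrow> real \<Rightarrow> complex \<Rightarrow> bit \<Rightarrow> bit \<Rightarrow> real" where
  "chan hA hB \<sigma> y a b =
     1 / (2 * pi * \<sigma>\<^sup>2) * exp (- (cmod (y - hA * bpsk a - hB * bpsk b))\<^sup>2 / (2 * \<sigma>\<^sup>2))"

definition phi_XC :: "complex \<Rightarrow> complex \<Rightarrow> real \<Rightarrow> complex ^ 'n \<Rightarrow> bit ^ 'n \<Rightarrow> real" where
  "phi_XC hA hB \<sigma> y c =
     (\<Prod>i\<in>UNIV. \<Sum>(a, b)\<in>{(a, b). a + b = c $ i}. chan hA hB \<sigma> (y $ i) a b)"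

text \<open>Law of the channel output multiplied by an independent uniform random sign.\<close>
definition chan_EDC :: "complex \<Rightarrow> complex \<Rightarrow> real \<Rightarrow> complex \<Rightarrow> bit \<Rightarrow> bit \<Rightarrow> real" where
  "chan_EDC hA hB \<sigma> y a b = 1 / 2 * (chan hA hB \<sigma> y a b + chan hA hB \<sigma> (- y) a b)"

text \<open>
  The code enters this metric: the sum ranges over pairs of codewords, whereas
  \<open>phi_XC\<close> sums over all pairs of bits in each position.
\<close>
definition phi_ML_EDC ::
  "complex \<Rightarrow> complex \<Rightarrow> real \<Rightarrow> (bit ^ 'n) set \<Rightarrow> complex ^ 'n \<Rightarrow> bit ^ 'n \<Rightarrow> real" where
  "phi_ML_EDC hA hB \<sigma> C y c =
     (\<Sum>(a, b)\<in>{(a, b). a \<in> C \<and> b \<in> C \<and> a + b = c}.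
        \<Prod>i\<in>UNIV. chan_EDC hA hB \<sigma> (y $ i) (a $ i) (b $ i))"

definition argmax_set :: "('a \<Rightarrow> real) \<Rightarrow> 'a set \<Rightarrow> 'a set" where
  "argmax_set f S = {x. is_arg_max f (\<lambda>u. u \<in> S) x}"

end

(* Negating the channel output is the same as flipping both input bits. Hence the transition density
   of the degraded channel is invariant under the sign and equals half of the per-position
   XOR metric, which depends on (a, b) only through a + b. All |C| pairs of codewords with sum c
   therefore contribute the same product, and the two metrics differ by the factor |C| / 2^N. *)
theory Submission
  imports Defs
begin

text \<open>This makes \<open>bit ^ 'n\<close> a finite type, so every code is a finite set and
  \<open>card C\<close> is a meaningful count.\<close>

instance bit :: finite
proof
  have "(UNIV :: bit set) \<subseteq> {0, 1}"
    by (auto intro: bit.exhaust)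
  then show "finite (UNIV :: bit set)"
    by (rule finite_subset) simp
qed

lemma bpsk_add_1: "bpsk (x + 1) = - bpsk x"
  by (cases x) (simp_all add: bpsk_def)

text \<open>Flipping a bit negates its BPSK symbol, so negating the output or flipping both bits
  gives residuals that differ only in sign, and \<open>cmod\<close> ignores the sign.\<close>

lemma chan_uminus: "chan hA hB \<sigma> (- y) a b = chan hA hB \<sigma> y (a + 1) (b + 1)"
proof -
  have "cmod (- y - hA * bpsk a - hB * bpsk b) = cmod (- (- y - hA * bpsk a - hB * bpsk b))"
    by (simp only: norm_minus_cancel)
  also have "- (- y - hA * bpsk a - hB * bpsk b) = y - hA * bpsk (a + 1) - hB * bpsk (b + 1)"
    unfolding bpsk_add_1 by simp
  finally show ?thesis
    by (simp add: chan_def)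
qed

lemma chan_EDC_uminus: "chan_EDC hA hB \<sigma> (- y) a b = chan_EDC hA hB \<sigma> y a b"
  by (simp add: chan_EDC_def add.commute)

lemma bit_pairs_same_sum:
  fixes a b :: bit
  shows "{(a', b'). a' + b' = a + b} = {(a, b), (a + 1, b + 1)}"
proof -
  have "a' + b' = a + b \<longleftrightarrow> a' = a \<and> b' = b \<or> a' = a + 1 \<and> b' = b + 1" for a' b'
    by (cases a; cases b; cases a'; cases b') simp_all
  then show ?thesis
    by auto
qed

lemma sum_chan_eq_chan_EDC:
  "(\<Sum>(a', b')\<in>{(a', b'). a' + b' = a + b}. chan hA hB \<sigma> y a' b') = 2 * chan_EDC hA hB \<sigma> y a b"
proof -
  \<comment> \<open>The two pairs with sum \<open>a + b\<close> are distinct, so the sum really has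
    two terms, which are the two that \<open>chan_EDC\<close> averages.\<close>
  have "a \<noteq> a + 1"
    by simp
  then show ?thesis
    unfolding bit_pairs_same_sum chan_EDC_def chan_uminus by (subst sum.insert) auto
qed

text \<open>The first entry \<open>a\<close> ranges freely over \<open>C\<close> and forces the
  second to be \<open>c - a\<close>, which closure under differences keeps in
  \<open>C\<close>.\<close>

lemma card_pairs_with_sum:
  fixes C :: "'a::ab_group_add set"
  assumes diff: "\<And>a b. a \<in> C \<Longrightarrow> b \<in> C \<Longrightarrow> a - b \<in> C" and "c \<in> C"
  shows "card {(a, b). a \<in> C \<and> b \<in> C \<and> a + b = c} = card C"
proof -
  have "{(a, b). a \<in> C \<and> b \<in> C \<and> a + b = c} = (\<lambda>a. (a, c - a)) ` C"
    using assms by (auto simp: image_iff algebra_simps)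
  moreover have "inj_on (\<lambda>a. (a, c - a)) C"
    by (rule inj_onI) simp
  ultimately show ?thesis
    by (simp add: card_image)
qed

text \<open>A positive factor common to all points of \<open>S\<close> preserves every comparison
  between them; values outside \<open>S\<close> never enter.\<close>

lemma argmax_set_scale:
  assumes "k > 0" and "\<And>x. x \<in> S \<Longrightarrow> f x = k * g x"
  shows "argmax_set f S = argmax_set g S"
  using assms by (auto simp: argmax_set_def is_arg_max_def)

lemma phi_ML_EDC_eq_phi_XC:
  fixes C :: "(bit ^ 'n) set" and y :: "complex ^ 'n" and z :: "real ^ 'n"
  assumes C: "vec.subspace C" and z: "\<And>i. z $ i \<in> {-1, 1}" and c: "c \<in> C"
  shows "phi_ML_EDC hA hB \<sigma> C (\<chi> i. y $ i * complex_of_real (z $ i)) c =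
    (real (card C) / 2 ^ CARD('n)) * phi_XC hA hB \<sigma> y c"
proof -
  \<comment> \<open>The right-hand side is free of \<open>a\<close>, \<open>b\<close> and
    \<open>z\<close>; each position contributes one factor 1/2.\<close>
  have prod_eq: "(\<Prod>i\<in>UNIV. chan_EDC hA hB \<sigma> (y $ i * complex_of_real (z $ i)) (a $ i) (b $ i)) =
      phi_XC hA hB \<sigma> y c / 2 ^ CARD('n)" if "a + b = c" for a b
  proof -
    have "chan_EDC hA hB \<sigma> (y $ i * complex_of_real (z $ i)) (a $ i) (b $ i) =
        (\<Sum>(a', b')\<in>{(a', b'). a' + b' = c $ i}. chan hA hB \<sigma> (y $ i) a' b') / 2" for i
    proof -
      \<comment> \<open>The density is even in the output, so the sign \<open>z $ i\<close> drops
        out.\<close>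
      have "chan_EDC hA hB \<sigma> (y $ i * complex_of_real (z $ i)) (a $ i) (b $ i) =
          chan_EDC hA hB \<sigma> (y $ i) (a $ i) (b $ i)"
        using z[of i] by (auto simp: chan_EDC_uminus)
      moreover have "c $ i = a $ i + b $ i"
        using that by auto
      ultimately show ?thesis
        by (simp only: sum_chan_eq_chan_EDC)
    qed
    then show ?thesis
      by (simp only: phi_XC_def prod_dividef prod_constant)
  qed
  have "phi_ML_EDC hA hB \<sigma> C (\<chi> i. y $ i * complex_of_real (z $ i)) c =
      (\<Sum>(a, b)\<in>{(a, b). a \<in> C \<and> b \<in> C \<and> a + b = c}. phi_XC hA hB \<sigma> y c / 2 ^ CARD('n))"
    unfolding phi_ML_EDC_def by (intro sum.cong) (auto simp: prod_eq)
  also have "\<dots> = real (card C) * (phi_XC hA hB \<sigma> y c / 2 ^ CARD('n))"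
    by (simp add: case_prod_unfold
        card_pairs_with_sum[OF vec.subspace_diff[OF C] c, unfolded case_prod_unfold])
  finally show ?thesis
    by simp
qed

theorem theorem1:
  fixes C :: "(bit ^ 'n) set"
    and N K :: nat
    and hA hB :: complex
    and \<sigma> :: real
    and y y' :: "complex ^ 'n"
    and z :: "real ^ 'n"
  assumes "binary_linear_code N K C"
    and "\<sigma>\<^sup>2 > 0"
    and "\<forall>i. z $ i \<in> {-1, 1}"
    and "y' = (\<chi> i. y $ i * complex_of_real (z $ i))"
  shows "argmax_set (phi_ML_EDC hA hB \<sigma> C y') C = argmax_set (phi_XC hA hB \<sigma> y) C"
proof (rule argmax_set_scale)
  have C: "vec.subspace C"
    using assms(1) by (simp add: binary_linear_code_def)
  \<comment> \<open>A subspace contains 0, so the scaling factor cannot vanish.\<close>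
  have "card C > 0"
    using vec.subspace_0[OF C] by (auto simp: card_gt_0_iff)
  then show "real (card C) / 2 ^ CARD('n) > 0"
    by simp
  show "phi_ML_EDC hA hB \<sigma> C y' c = (real (card C) / 2 ^ CARD('n)) * phi_XC hA hB \<sigma> y c"
    if "c \<in> C" for c
    using phi_ML_EDC_eq_phi_XC[OF C _ that] assms(3,4) by simp
qed

end
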